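(* Let $n\ge 2$. For any convex body $K\subset\mathbb{R}^n$ one has $$\sup_{u,v\in S^{n-1},\,u\neq\pm v}\Delta d_K(u,v)\le\hat N_K\qquad\text{and}\qquad d_K'(u)\le q_K(u)\ \text{ for every } u\in S^{n-1},$$ where $\hat N_K:=\max_{u\in S^{n-1}}q_K(u)$.
   Context: A convex body in $\mathbb{R}^n$ is a compact convex set with nonempty interior. A supporting hyperplane of $K$ is an affine hyperplane that intersects $K$ but not its interior. For $u\in S^{n-1}$ (the Euclidean unit sphere of $\mathbb{R}^n$), $d_K(u)$ is the maximal length of a chord of $K$ parallel to $u$. A diametral chord for $u$ is a chord $[AB]$ of $K$ parallel to $u$ with $|AB|=d_K(u)$; for any such chord there exist parallel supporting hyperplanes of $K$ at $A$ and $B$. Define $$r_K(u):=\inf\{\operatorname{dist}(H_1,H_2)\},$$ where the infimum is over all diametral chords $[AB]$ for $u$ and all pairs of distinct parallel supporting hyperplanes $H_1\ni A$, $H_2\ni B$ of $K$, and $$q_K(u):=d_K(u)\sqrt{\frac{d_K(u)^2}{r_K(u)^2}-1}.$$ The function $q_K$ is upper semicontinuous on $S^{n-1}$, so its maximum is attained. $\rho(u,v):=\arccos|\langle u,v\rangle|$; for $u\ne\pm v$, $\Delta d_K(u,v):=|d_K(u)-d_K(v)|/\rho(u,v)$; and $d_K'(u):=\limsup_{u',u''\to u}\Delta d_K(u',u'')$, the limsup being over $u',u''\in S^{n-1}$, $u'\ne\pm u''$, both tending to $u$. *)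

theory Defs
  imports "HOL-Analysis.Analysis"
begin

definition convex_body :: "'a::euclidean_space set \<Rightarrow> bool" where
  "convex_body K \<longleftrightarrow> compact K \<and> convex K \<and> interior K \<noteq> {}"

definition hyperplane :: "'a::euclidean_space set \<Rightarrow> bool" where
  "hyperplane H \<longleftrightarrow> (\<exists>a b. a \<noteq> 0 \<and> H = {x. a \<bullet> x = b})"

definition supporting_hyperplane :: "'a::euclidean_space set \<Rightarrow> 'a set \<Rightarrow> bool" where
  "supporting_hyperplane K H \<longleftrightarrow> hyperplane H \<and> H \<inter> K \<noteq> {} \<and> H \<inter> interior K = {}"

text \<open>A chord is a nondegenerate segment joining two boundary points. It is given by its pair of
  endpoints, in either order, so the scalar below may have either sign.\<close>

definition chord_parallel :: "'a::euclidean_space set \<Rightarrow> 'a \<Rightarrow> 'a \<Rightarrow> 'a \<Rightarrow> bool" where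
  "chord_parallel K u A B \<longleftrightarrow>
     A \<in> frontier K \<and> B \<in> frontier K \<and> A \<noteq> B \<and> (\<exists>t. B - A = t *\<^sub>R u)"

definition max_chord :: "'a::euclidean_space set \<Rightarrow> 'a \<Rightarrow> real" where
  "max_chord K u = (GREATEST l. \<exists>A B. chord_parallel K u A B \<and> l = dist A B)"

definition diametral_chord :: "'a::euclidean_space set \<Rightarrow> 'a \<Rightarrow> 'a \<Rightarrow> 'a \<Rightarrow> bool" where
  "diametral_chord K u A B \<longleftrightarrow> chord_parallel K u A B \<and> dist A B = max_chord K u"

definition r_fun :: "'a::euclidean_space set \<Rightarrow> 'a \<Rightarrow> real" where
  "r_fun K u = Inf {setdist H1 H2 | H1 H2. \<exists>A B. diametral_chord K u A B \<and>
     supporting_hyperplane K H1 \<and> supporting_hyperplane K H2 \<and>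
     A \<in> H1 \<and> B \<in> H2 \<and> affine_parallel H1 H2 \<and> H1 \<noteq> H2}"

definition q_fun :: "'a::euclidean_space set \<Rightarrow> 'a \<Rightarrow> real" where
  "q_fun K u = max_chord K u * sqrt ((max_chord K u)\<^sup>2 / (r_fun K u)\<^sup>2 - 1)"

definition N_hat :: "'a::euclidean_space set \<Rightarrow> real" where
  "N_hat K = (GREATEST y. y \<in> q_fun K ` sphere 0 1)"

definition rho :: "'a::euclidean_space \<Rightarrow> 'a \<Rightarrow> real" where
  "rho u v = arccos \<bar>u \<bullet> v\<bar>"

definition Delta_d :: "'a::euclidean_space set \<Rightarrow> 'a \<Rightarrow> 'a \<Rightarrow> real" where
  "Delta_d K u v = \<bar>max_chord K u - max_chord K v\<bar> / rho u v"

definition direction_pairs :: "('a::euclidean_space \<times> 'a) set" where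
  "direction_pairs = {(u, v). u \<in> sphere 0 1 \<and> v \<in> sphere 0 1 \<and> u \<noteq> v \<and> u \<noteq> - v}"

text \<open>The upper limit is taken in the extended reals. The point \<open>(u, u)\<close> is not in
  \<open>direction_pairs\<close>, so the punctured filter \<open>at _ within _\<close> excludes no admissible pair;
  one component may equal \<open>u\<close>.\<close>

definition d_prime :: "'a::euclidean_space set \<Rightarrow> 'a \<Rightarrow> ereal" where
  "d_prime K u = Limsup (at (u, u) within direction_pairs) (\<lambda>(v, w). ereal (Delta_d K v w))"

end

theory Submission
  imports Defs
begin

text \<open>The maximal chord length \<open>d\<close> of \<open>K\<close> is the radial function of the difference body \<open>K - K\<close>, and
  pairs of parallel supporting hyperplanes at the ends of diametral chords for \<open>u\<close> correspond to unit
  normals \<open>a\<close> of \<open>K - K\<close> at \<open>d u *\<^sub>R u\<close>, at distance \<open>d u * (a \<bullet> u)\<close>. Hence \<open>q u\<close> is \<open>d u\<close> times the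
  largest tangent of an angle between \<open>u\<close> and such a normal. Since the set of pairs (direction,
  normal) is compact, \<open>q\<close> is upper semicontinuous and attains its maximum. Testing the supporting
  inequality at \<open>v\<close> with the boundary point in direction \<open>u\<close> gives
  \<open>\<bar>d u - d v\<bar> \<le> \<rho> * max (q u) (q v) + C * \<rho>\<^sup>2\<close> for the angle \<open>\<rho>\<close> between the lines spanned by
  \<open>u\<close> and \<open>v\<close>, with a uniform \<open>C\<close>. The local bound follows from semicontinuity, the global one by
  subdividing the great circle arc from \<open>v\<close> to \<open>u\<close>.\<close>

section \<open>The difference body: symmetric, compact, convex, with 0 in its interior\<close>

definition diff_body :: "'a::euclidean_space set \<Rightarrow> 'a set" where
  "diff_body K = {x - y | x y. x \<in> K \<and> y \<in> K}"

text \<open>For a convex body \<open>K\<close> and a unit vector \<open>u\<close>, these are the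
  outer unit normals of the difference body at its boundary point
  \<open>max_chord K u *\<^sub>R u\<close>.\<close>

definition unit_normals :: "'a::euclidean_space set \<Rightarrow> 'a \<Rightarrow> 'a set" where
  "unit_normals K u = {a. norm a = 1 \<and> (\<forall>x\<in>diff_body K. a \<bullet> x \<le> max_chord K u * (a \<bullet> u))}"

lemma diff_bodyI: "x \<in> K \<Longrightarrow> y \<in> K \<Longrightarrow> x - y \<in> diff_body K"
  by (auto simp: diff_body_def)

lemma diff_body_uminus: "x \<in> diff_body K \<Longrightarrow> - x \<in> diff_body K"
  by (auto simp: diff_body_def) (metis minus_diff_eq)

lemma compact_diff_body: "convex_body K \<Longrightarrow> compact (diff_body K)"
  unfolding convex_body_def diff_body_def by (intro compact_differences) auto

lemma convex_diff_body:
  assumes "convex_body K"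
  shows "convex (diff_body K)"
proof -
  have "diff_body K = (\<Union>x\<in>K. \<Union>y\<in>K. {x - y})"
    by (auto simp: diff_body_def)
  with assms show ?thesis
    by (simp add: convex_body_def convex_differences)
qed

lemma diff_body_contains_cball:
  assumes "convex_body K"
  obtains e where "e > 0" "cball 0 e \<subseteq> diff_body K"
proof -
  obtain c where "c \<in> interior K"
    using assms by (auto simp: convex_body_def)
  then obtain e where e: "e > 0" "cball c e \<subseteq> K"
    by (auto simp: mem_interior_cball)
  have "x \<in> diff_body K" if "x \<in> cball 0 e" for x
  proof -
    have "c + x \<in> K" "c \<in> K"
      using that e by (auto intro!: subsetD[OF e(2)] simp: dist_norm)
    then show ?thesis
      using diff_bodyI[of "c + x" K c] by simp
  qed
  with e that show ?thesis by blast
qed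

section \<open>Maximal chord length as radial function of the difference body\<close>

text \<open>If \<open>A\<close> were interior, the segment could be prolonged beyond
  \<open>A\<close> inside \<open>K\<close>, giving a longer multiple of \<open>u\<close> in the
  difference body.\<close>

lemma frontier_of_longest_chord:
  assumes "compact K" "norm u = 1" "A \<in> K" "B \<in> K" "B - A = t *\<^sub>R u"
    and max: "\<And>s. s *\<^sub>R u \<in> diff_body K \<Longrightarrow> \<bar>s\<bar> \<le> \<bar>t\<bar>"
  shows "A \<in> frontier K"
proof (rule ccontr)
  assume "A \<notin> frontier K"
  with assms have "A \<in> interior K"
    by (auto simp: frontier_def compact_imp_closed closure_closed)
  then obtain e where e: "e > 0" "cball A e \<subseteq> K"
    by (auto simp: mem_interior_cball)
  \<comment> \<open>The sign of \<open>s\<close> follows that of \<open>t\<close>, so that moving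
    \<open>A\<close> by \<open>- s *\<^sub>R u\<close> lengthens the segment whichever way it
    points.\<close>
  define s where "s = (if t \<ge> 0 then e else - e)"
  have "A - s *\<^sub>R u \<in> K"
    using e assms by (intro subsetD[OF e(2)]) (auto simp: dist_norm s_def)
  then have "B - (A - s *\<^sub>R u) \<in> diff_body K"
    using assms by (intro diff_bodyI)
  moreover have "B - (A - s *\<^sub>R u) = (t + s) *\<^sub>R u"
    using assms(5) by (simp add: algebra_simps)
  ultimately have "\<bar>t + s\<bar> \<le> \<bar>t\<bar>"
    using max by simp
  with e show False
    by (auto simp: s_def split: if_splits)
qed

lemma longest_chord_frontier:
  assumes "compact K" "norm u = 1" "A \<in> K" "B \<in> K" "B - A = t *\<^sub>R u"
    and max: "\<And>s. s *\<^sub>R u \<in> diff_body K \<Longrightarrow> \<bar>s\<bar> \<le> \<bar>t\<bar>"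
  shows "A \<in> frontier K \<and> B \<in> frontier K"
proof
  show "A \<in> frontier K"
    using frontier_of_longest_chord assms by blast
  have "A - B = (- t) *\<^sub>R u"
    using assms(5) by (metis minus_diff_eq scaleR_minus_left)
  then show "B \<in> frontier K"
    using frontier_of_longest_chord[of K u B A "- t"] assms by auto
qed

lemma longest_diff_body_vector:
  fixes u :: "'a::euclidean_space"
  assumes "convex_body K" "norm u = 1"
  obtains t where "t > 0" "t *\<^sub>R u \<in> diff_body K"
    "\<And>s. s *\<^sub>R u \<in> diff_body K \<Longrightarrow> \<bar>s\<bar> \<le> t"
proof -
  \<comment> \<open>For a unit vector \<open>u\<close> the second set is the line spanned by
    \<open>u\<close>, written as the solution set of a continuous equation so that it is
    closed.\<close>
  define S where "S = diff_body K \<inter> {x. x = (x \<bullet> u) *\<^sub>R u}"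
  obtain e where e: "e > 0" "cball 0 e \<subseteq> diff_body K"
    using diff_body_contains_cball assms by blast
  have uu: "u \<bullet> u = 1"
    using assms by (simp add: dot_square_norm)
  have S_iff: "s *\<^sub>R u \<in> S \<longleftrightarrow> s *\<^sub>R u \<in> diff_body K" for s
    by (simp add: S_def uu)
  have eu: "e *\<^sub>R u \<in> S"
    using e assms by (auto simp: S_iff intro!: subsetD[OF e(2)])
  have "compact S"
    unfolding S_def
    by (intro compact_Int_closed compact_diff_body assms closed_Collect_eq continuous_intros)
  moreover have "continuous_on S (\<lambda>x. x \<bullet> u)"
    by (intro continuous_intros)
  ultimately obtain x where x: "x \<in> S" "\<And>y. y \<in> S \<Longrightarrow> y \<bullet> u \<le> x \<bullet> u"
    using eu continuous_attains_sup[of S "\<lambda>x. x \<bullet> u"] by blast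
  have xu: "x = (x \<bullet> u) *\<^sub>R u" "x \<in> diff_body K"
    using x(1) by (auto simp: S_def)
  have le: "s \<le> x \<bullet> u" if "s *\<^sub>R u \<in> diff_body K" for s
    using x(2)[of "s *\<^sub>R u"] that by (simp add: S_iff uu)
  show ?thesis
  proof (rule that)
    show "x \<bullet> u > 0"
      using le[of e] eu e by (simp add: S_iff)
    show "(x \<bullet> u) *\<^sub>R u \<in> diff_body K"
      using xu by simp
    show "\<bar>s\<bar> \<le> x \<bullet> u" if "s *\<^sub>R u \<in> diff_body K" for s
      using le[OF that] le[of "- s"] diff_body_uminus[OF that] by auto
  qed
qed

lemma chord_parallel_diff_body:
  assumes "compact K" "chord_parallel K u A B" "norm u = 1"
  obtains t where "B - A = t *\<^sub>R u" "dist A B = \<bar>t\<bar>" "A \<in> K" "B \<in> K"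
    "t *\<^sub>R u \<in> diff_body K"
proof -
  obtain t where t: "B - A = t *\<^sub>R u"
    using assms by (auto simp: chord_parallel_def)
  have AB: "A \<in> K" "B \<in> K"
    using assms frontier_subset_closed[of K]
    by (auto simp: chord_parallel_def compact_imp_closed)
  have "dist A B = \<bar>t\<bar>"
    using t assms by (simp add: dist_norm norm_minus_commute[of A])
  then show ?thesis
    using that t AB diff_bodyI[of B K A] by metis
qed

text \<open>\<open>GREATEST\<close> is meaningful only if a maximum is attained. Compactness gives a
  longest multiple of \<open>u\<close> in the difference body, and a segment in \<open>K\<close>
  realising it has both ends on the frontier, so it is an admissible chord.\<close>

lemma max_chord_diff_body:
  fixes u :: "'a::euclidean_space"
  assumes "convex_body K" "norm u = 1"
  shows max_chord_pos: "max_chord K u > 0"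
    and max_chord_mem: "max_chord K u *\<^sub>R u \<in> diff_body K"
    and max_chord_max: "\<And>s. s *\<^sub>R u \<in> diff_body K \<Longrightarrow> \<bar>s\<bar> \<le> max_chord K u"
    and diametral_chord_exists: "\<exists>A B. diametral_chord K u A B \<and> B - A = max_chord K u *\<^sub>R u"
proof -
  obtain t where t: "t > 0" "t *\<^sub>R u \<in> diff_body K"
    "\<And>s. s *\<^sub>R u \<in> diff_body K \<Longrightarrow> \<bar>s\<bar> \<le> t"
    using longest_diff_body_vector[OF assms] by blast
  have cpt: "compact K"
    using assms by (simp add: convex_body_def)
  obtain A B where AB: "A \<in> K" "B \<in> K" "B - A = t *\<^sub>R u"
    using t(2) by (force simp: diff_body_def)
  have fr: "A \<in> frontier K \<and> B \<in> frontier K"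
    using longest_chord_frontier[OF cpt assms(2) AB] t by simp
  have dAB: "dist A B = t"
    using AB(3) t assms by (simp add: dist_norm norm_minus_commute[of A])
  then have chord: "chord_parallel K u A B"
    using fr AB t by (auto simp: chord_parallel_def)
  have eq: "max_chord K u = t"
    unfolding max_chord_def
  proof (rule Greatest_equality)
    show "\<exists>A B. chord_parallel K u A B \<and> t = dist A B"
      using chord dAB by blast
    show "l \<le> t" if "\<exists>A B. chord_parallel K u A B \<and> l = dist A B" for l
      using that t(3) by (metis chord_parallel_diff_body[OF cpt _ assms(2)])
  qed
  show "max_chord K u > 0" "max_chord K u *\<^sub>R u \<in> diff_body K"
    "\<And>s. s *\<^sub>R u \<in> diff_body K \<Longrightarrow> \<bar>s\<bar> \<le> max_chord K u"
    using t by (auto simp: eq)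
  show "\<exists>A B. diametral_chord K u A B \<and> B - A = max_chord K u *\<^sub>R u"
    using chord AB dAB by (auto simp: eq diametral_chord_def)
qed

lemma max_chord_uminus:
  assumes "convex_body K" "norm u = 1"
  shows "max_chord K (- u) = max_chord K u"
proof (rule antisym)
  show "max_chord K (- u) \<le> max_chord K u"
    using max_chord_max[OF assms, of "- max_chord K (- u)"] max_chord_mem[of K "- u"] assms by auto
  show "max_chord K u \<le> max_chord K (- u)"
    using max_chord_max[of K "- u" "- max_chord K u"] max_chord_mem[OF assms] assms by auto
qed

section \<open>Unit normals of the difference body\<close>

lemma unit_normals_nonempty:
  assumes "convex_body K" "norm u = 1"
  shows "unit_normals K u \<noteq> {}"
proof -
  let ?x = "max_chord K u *\<^sub>R u"
  note cl = compact_imp_closed[OF compact_diff_body[OF assms(1)]]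
  obtain e where e: "e > 0" "cball 0 e \<subseteq> diff_body K"
    using diff_body_contains_cball assms by blast
  then have "0 \<in> interior (diff_body K)"
    by (auto simp: mem_interior_cball)
  then have ri: "rel_interior (diff_body K) = interior (diff_body K)"
    by (intro interior_rel_interior_gen[symmetric] rel_interior_nonempty_interior) auto
  \<comment> \<open>An interior point could be pushed further out along \<open>u\<close>, against
    maximality.\<close>
  have "?x \<notin> interior (diff_body K)"
  proof
    assume "?x \<in> interior (diff_body K)"
    then obtain d where d: "d > 0" "cball ?x d \<subseteq> diff_body K"
      by (auto simp: mem_interior_cball)
    have "(max_chord K u + d) *\<^sub>R u \<in> diff_body K"
      using d assms by (intro subsetD[OF d(2)]) (auto simp: dist_norm algebra_simps)
    from max_chord_max[OF assms this] d show False by simp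
  qed
  then obtain a where a: "a \<noteq> 0" "\<And>y. y \<in> diff_body K \<Longrightarrow> a \<bullet> ?x \<le> a \<bullet> y"
    using supporting_hyperplane_relative_frontier[of "diff_body K" ?x] ri cl
      convex_diff_body[OF assms(1)] max_chord_mem[OF assms]
    by (metis closure_closed)
  \<comment> \<open>The vector \<open>a\<close> attains its minimum over the body at
    \<open>?x\<close>, so it points inward; the outer unit normal is its normalised
    negative.\<close>
  have "- sgn a \<in> unit_normals K u"
  proof -
    have "- sgn a \<bullet> x \<le> max_chord K u * (- sgn a \<bullet> u)" if "x \<in> diff_body K" for x
      using a(2)[OF that] a(1) by (simp add: sgn_div_norm divide_simps)
    then show ?thesis
      using a(1) by (simp add: unit_normals_def norm_sgn)
  qed
  then show ?thesis by blast
qed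

text \<open>Test the supporting inequality at the point \<open>e *\<^sub>R a\<close> of the ball.
  The bound is the same for all \<open>u\<close> and \<open>a\<close>, so normals stay uniformly
  away from being orthogonal to their direction.\<close>

lemma unit_normals_lower:
  assumes "a \<in> unit_normals K u" "0 < e" "cball 0 e \<subseteq> diff_body K"
  shows "e \<le> max_chord K u * (a \<bullet> u)"
proof -
  have "norm a = 1"
    using assms by (simp add: unit_normals_def)
  then have "e *\<^sub>R a \<in> diff_body K"
    using assms by (intro subsetD[OF assms(3)]) auto
  then have "a \<bullet> (e *\<^sub>R a) \<le> max_chord K u * (a \<bullet> u)"
    using assms(1) by (auto simp: unit_normals_def)
  with \<open>norm a = 1\<close> show ?thesis
    by (simp add: dot_square_norm)
qed

lemma unit_normals_pos:
  assumes "convex_body K" "norm u = 1" "a \<in> unit_normals K u"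
  shows "a \<bullet> u > 0"
proof -
  obtain e where e: "e > 0" "cball 0 e \<subseteq> diff_body K"
    using diff_body_contains_cball assms by blast
  show ?thesis
    using unit_normals_lower[OF assms(3) e] e max_chord_pos[OF assms(1,2)]
    by (meson less_le_trans zero_less_mult_pos)
qed

lemma compact_unit_normals: "compact (unit_normals K u)"
proof -
  have eq: "unit_normals K u = sphere 0 1 \<inter> (\<Inter>x\<in>diff_body K. {a. a \<bullet> x \<le> max_chord K u * (a \<bullet> u)})"
    by (auto simp: unit_normals_def)
  show ?thesis
    unfolding eq
    by (intro compact_Int_closed compact_sphere closed_INT ballI closed_Collect_le continuous_intros)
qed

section \<open>Parallel supporting hyperplanes and unit normals\<close>

lemma setdist_parallel_hyperplanes:
  fixes a :: "'a::euclidean_space"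
  assumes "norm a = 1"
  shows "setdist {x. a \<bullet> x = b} {x. a \<bullet> x = c} = \<bar>c - b\<bar>"
proof -
  have aa: "a \<bullet> a = 1"
    using assms by (simp add: dot_square_norm)
  have d: "dist (b *\<^sub>R a) (c *\<^sub>R a) = \<bar>c - b\<bar>"
    using assms by (simp add: dist_norm flip: scaleR_diff_left)
  \<comment> \<open>The points \<open>b *\<^sub>R a\<close> and \<open>c *\<^sub>R a\<close> on the
    common normal realise the distance; Cauchy-Schwarz shows that no other pair is closer.\<close>
  have "setdist {x. a \<bullet> x = b} {x. a \<bullet> x = c} = dist (b *\<^sub>R a) (c *\<^sub>R a)"
  proof (rule setdist_unique)
    fix x y assume "x \<in> {x. a \<bullet> x = b} \<and> y \<in> {x. a \<bullet> x = c}"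
    then have "\<bar>c - b\<bar> = \<bar>a \<bullet> (y - x)\<bar>"
      by (simp add: inner_diff_right)
    also have "\<dots> \<le> norm a * norm (y - x)"
      by (rule Cauchy_Schwarz_ineq2)
    finally show "dist (b *\<^sub>R a) (c *\<^sub>R a) \<le> dist x y"
      using assms by (simp add: d) (simp add: dist_norm norm_minus_commute)
  qed (auto simp: aa)
  with d show ?thesis by simp
qed

text \<open>The definition of a supporting hyperplane only says that it misses the interior. Since
  the interior is connected it lies on one side, and its closure is \<open>K\<close>; the point
  \<open>p\<close> tells which side.\<close>

lemma supporting_hyperplane_one_side:
  assumes "convex_body K" "supporting_hyperplane K {x. a \<bullet> x = b}" "p \<in> K" "a \<bullet> p > b" "x \<in> K"
  shows "a \<bullet> x \<ge> b"
proof -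
  have cv: "convex K" "interior K \<noteq> {}" "closed K"
    using assms by (auto simp: convex_body_def compact_imp_closed)
  have K: "closure (interior K) = K"
    using cv by (simp add: convex_closure_interior)
  have ne: "a \<bullet> z \<noteq> b" if "z \<in> interior K" for z
    using that assms(2) by (auto simp: supporting_hyperplane_def)
  have conn: "connected (interior K)"
    using cv by (simp add: convex_connected convex_interior)
  have "(\<forall>z\<in>interior K. a \<bullet> z \<ge> b) \<or> (\<forall>z\<in>interior K. a \<bullet> z \<le> b)"
    using connected_ivt_hyperplane[OF conn] ne by (meson linear)
  then show ?thesis
  proof
    assume *: "\<forall>z\<in>interior K. a \<bullet> z \<ge> b"
    have "closure (interior K) \<subseteq> {x. a \<bullet> x \<ge> b}"
      using * by (intro closure_minimal closed_Collect_le continuous_intros) auto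
    with K assms show ?thesis by auto
  next
    assume *: "\<forall>z\<in>interior K. a \<bullet> z \<le> b"
    have "closure (interior K) \<subseteq> {x. a \<bullet> x \<le> b}"
      using * by (intro closure_minimal closed_Collect_le continuous_intros) auto
    with K assms show ?thesis by auto
  qed
qed

text \<open>The hyperplanes orthogonal to \<open>a\<close> through the ends of a diametral chord
  bound a strip that contains \<open>K\<close>, by the normal inequality for the differences
  \<open>B - x\<close> and \<open>x - A\<close>.\<close>

lemma unit_normal_imp_strip:
  assumes "convex_body K" "norm u = 1" "a \<in> unit_normals K u"
  shows "\<exists>H1 H2 A B. max_chord K u * (a \<bullet> u) = setdist H1 H2 \<and> diametral_chord K u A B \<and>
     supporting_hyperplane K H1 \<and> supporting_hyperplane K H2 \<and>
     A \<in> H1 \<and> B \<in> H2 \<and> affine_parallel H1 H2 \<and> H1 \<noteq> H2"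
proof -
  obtain A B where AB: "diametral_chord K u A B" "B - A = max_chord K u *\<^sub>R u"
    using diametral_chord_exists assms by blast
  have cpt: "compact K" using assms by (simp add: convex_body_def)
  have na: "norm a = 1" and le: "\<And>x. x \<in> diff_body K \<Longrightarrow> a \<bullet> x \<le> max_chord K u * (a \<bullet> u)"
    using assms by (auto simp: unit_normals_def)
  have aa: "a \<bullet> a = 1"
    using na by (simp add: dot_square_norm)
  have ABK: "A \<in> K" "B \<in> K"
    using AB chord_parallel_diff_body[OF cpt _ assms(2)] by (metis diametral_chord_def)+
  have dAB: "a \<bullet> B - a \<bullet> A = max_chord K u * (a \<bullet> u)"
    using AB(2) by (metis inner_diff_right inner_scaleR_right)
  have pos: "max_chord K u * (a \<bullet> u) > 0"
    using unit_normals_pos[OF assms] max_chord_pos[OF assms(1,2)] by simp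
  let ?H = "\<lambda>b. {x. a \<bullet> x = b}"
  have between: "a \<bullet> A \<le> a \<bullet> x \<and> a \<bullet> x \<le> a \<bullet> B" if "x \<in> K" for x
    using le[OF diff_bodyI[OF ABK(2) that]] le[OF diff_bodyI[OF that ABK(1)]] dAB
    by (simp add: inner_diff_right)
  \<comment> \<open>An interior point on either hyperplane could be moved along \<open>a\<close> out
    of the strip without leaving \<open>K\<close>.\<close>
  have strict: "a \<bullet> z \<noteq> a \<bullet> A \<and> a \<bullet> z \<noteq> a \<bullet> B" if z: "z \<in> interior K" for z
  proof -
    obtain e where e: "e > 0" "cball z e \<subseteq> K"
      using z by (auto simp: mem_interior_cball)
    have "z + e *\<^sub>R a \<in> K" "z - e *\<^sub>R a \<in> K"
      using e na by (auto intro!: subsetD[OF e(2)] simp: dist_norm)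
    then have "a \<bullet> (z + e *\<^sub>R a) \<le> a \<bullet> B" "a \<bullet> A \<le> a \<bullet> (z - e *\<^sub>R a)"
      using between by blast+
    with e aa show ?thesis by (simp add: inner_diff_right inner_add_right)
  qed
  have hyp: "hyperplane (?H b)" for b
    using na unfolding hyperplane_def by (metis norm_zero zero_neq_one)
  have supp: "supporting_hyperplane K (?H (a \<bullet> A))" "supporting_hyperplane K (?H (a \<bullet> B))"
    using hyp strict ABK by (auto simp: supporting_hyperplane_def)
  have par: "affine_parallel (?H (a \<bullet> A)) (?H (a \<bullet> B))"
    unfolding affine_parallel_def
  proof (intro exI[of _ "B - A"] set_eqI iffI)
    fix x assume "x \<in> ?H (a \<bullet> B)"
    then have "x = (B - A) + (x - (B - A))" "x - (B - A) \<in> ?H (a \<bullet> A)"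
      by (auto simp: inner_diff_right)
    then show "x \<in> (+) (B - A) ` ?H (a \<bullet> A)" by blast
  qed (auto simp: inner_diff_right inner_add_right)
  have "B \<notin> ?H (a \<bullet> A)"
    using dAB pos by auto
  then have "?H (a \<bullet> A) \<noteq> ?H (a \<bullet> B)" by blast
  moreover have "max_chord K u * (a \<bullet> u) = setdist (?H (a \<bullet> A)) (?H (a \<bullet> B))"
    using setdist_parallel_hyperplanes[OF na] dAB pos by simp
  ultimately show ?thesis
    using AB(1) supp par by blast
qed

lemma strip_imp_unit_normal:
  assumes "convex_body K" "norm u = 1" "diametral_chord K u A B"
    "supporting_hyperplane K H1" "supporting_hyperplane K H2"
    "A \<in> H1" "B \<in> H2" "affine_parallel H1 H2" "H1 \<noteq> H2"
  shows "\<exists>a\<in>unit_normals K u. setdist H1 H2 = max_chord K u * (a \<bullet> u)"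
proof -
  have cpt: "compact K" using assms by (simp add: convex_body_def)
  obtain a0 b0 where H1: "a0 \<noteq> 0" "H1 = {x. a0 \<bullet> x = b0}"
    using assms(4) by (auto simp: supporting_hyperplane_def hyperplane_def)
  obtain c where H2: "H2 = (\<lambda>x. c + x) ` H1"
    using assms(8) by (auto simp: affine_parallel_def)
  define g where "g = sgn a0"
  have g1: "norm g = 1"
    using H1 by (simp add: g_def norm_sgn)
  have H1g: "H1 = {x. g \<bullet> x = g \<bullet> A}"
    using assms(6) H1 by (auto simp: g_def sgn_div_norm)
  \<comment> \<open>A translate of \<open>H1\<close> has the same normal, and it is determined by
    its point \<open>B\<close>.\<close>
  have H2g: "H2 = {x. g \<bullet> x = g \<bullet> B}"
  proof -
    obtain y where y: "B = c + y" "g \<bullet> y = g \<bullet> A"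
      using assms(7) H2 H1g by auto
    have "x \<in> H2" if "g \<bullet> x = g \<bullet> B" for x
    proof -
      have "x = c + (x - c)" "x - c \<in> H1"
        using that y by (auto simp: H1g inner_diff_right inner_add_right)
      then show ?thesis unfolding H2 by blast
    qed
    moreover have "g \<bullet> x = g \<bullet> B" if "x \<in> H2" for x
      using that y by (auto simp: H2 H1g inner_add_right)
    ultimately show ?thesis by blast
  qed
  obtain t where t: "B - A = t *\<^sub>R u" "dist A B = \<bar>t\<bar>" "A \<in> K" "B \<in> K"
    using chord_parallel_diff_body[OF cpt _ assms(2)] assms(3) by (metis diametral_chord_def)
  have td: "\<bar>t\<bar> = max_chord K u"
    using t assms(3) by (simp add: diametral_chord_def)
  \<comment> \<open>Stated for any unit normal \<open>f\<close> increasing from \<open>A\<close> to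
    \<open>B\<close>; at the end it is used for whichever of \<open>g\<close> and \<open>- g\<close>
    does so.\<close>
  have main: "\<exists>a\<in>unit_normals K u. f \<bullet> B - f \<bullet> A = max_chord K u * (a \<bullet> u)"
    if f: "norm f = 1" "H1 = {x. f \<bullet> x = f \<bullet> A}" "H2 = {x. f \<bullet> x = f \<bullet> B}" "f \<bullet> A < f \<bullet> B" for f
  proof -
    have lo: "f \<bullet> A \<le> f \<bullet> x" if "x \<in> K" for x
      using supporting_hyperplane_one_side[of K f "f \<bullet> A" B x] that t f assms by auto
    \<comment> \<open>The upper bound at \<open>B\<close> is the one-sided lower bound for the
      reversed normal.\<close>
    have "supporting_hyperplane K {x. - f \<bullet> x = - f \<bullet> B}"
      using assms(5) f(3) by simp
    note hi_support = supporting_hyperplane_one_side[OF assms(1) this]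
    have hi: "f \<bullet> x \<le> f \<bullet> B" if "x \<in> K" for x
      using hi_support[of A x] that t(3) f(4) by simp
    have le: "f \<bullet> x \<le> f \<bullet> B - f \<bullet> A" if x: "x \<in> diff_body K" for x
    proof -
      obtain y z where "x = y - z" "y \<in> K" "z \<in> K"
        using x by (auto simp: diff_body_def)
      with lo[of z] hi[of y] show ?thesis by (simp add: inner_diff_right)
    qed
    have ft: "f \<bullet> B - f \<bullet> A = t * (f \<bullet> u)"
      using t(1) by (metis inner_diff_right inner_scaleR_right)
    show ?thesis
    \<comment> \<open>A chord may be listed against the direction of \<open>u\<close>; then
      \<open>- f\<close> is the outer normal at the point in direction \<open>u\<close>.\<close>
    proof (cases "t \<ge> 0")
      case True
      then have "f \<in> unit_normals K u"
        using f le td ft by (auto simp: unit_normals_def)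
      with ft td True show ?thesis by auto
    next
      case False
      then have td': "max_chord K u = - t"
        using td by simp
      have "- f \<bullet> x \<le> max_chord K u * (- f \<bullet> u)" if "x \<in> diff_body K" for x
        using le[OF diff_body_uminus[OF that]] ft by (simp add: td')
      then have "- f \<in> unit_normals K u"
        using f(1) by (simp add: unit_normals_def)
      with ft show ?thesis by (intro bexI[of _ "- f"]) (auto simp: td')
    qed
  qed
  have sd: "setdist H1 H2 = \<bar>g \<bullet> B - g \<bullet> A\<bar>"
    using setdist_parallel_hyperplanes[OF g1] H1g H2g by simp
  have "g \<bullet> A \<noteq> g \<bullet> B"
    using H1g H2g assms(9) by auto
  then consider "g \<bullet> A < g \<bullet> B" | "g \<bullet> B < g \<bullet> A" by linarith
  then show ?thesis
  proof cases
    case 1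
    then show ?thesis
      using main[of g] g1 H1g H2g sd by auto
  next
    case 2
    then show ?thesis
      using main[of "- g"] g1 H1g H2g sd by auto
  qed
qed

section \<open>The functions r and q in terms of unit normals\<close>

lemma r_fun_eq_Inf:
  assumes "convex_body K" "norm u = 1"
  shows "r_fun K u = Inf ((\<lambda>a. max_chord K u * (a \<bullet> u)) ` unit_normals K u)"
proof -
  have "{setdist H1 H2 | H1 H2. \<exists>A B. diametral_chord K u A B \<and>
     supporting_hyperplane K H1 \<and> supporting_hyperplane K H2 \<and>
     A \<in> H1 \<and> B \<in> H2 \<and> affine_parallel H1 H2 \<and> H1 \<noteq> H2} =
     (\<lambda>a. max_chord K u * (a \<bullet> u)) ` unit_normals K u"
    using strip_imp_unit_normal[OF assms] unit_normal_imp_strip[OF assms] by (fast intro!: set_eqI)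
  then show ?thesis
    by (simp add: r_fun_def)
qed

text \<open>By compactness some normal \<open>a0\<close> has the least
  \<open>a0 \<bullet> u\<close>, so the infimum \<open>r_fun K u\<close> is
  \<open>max_chord K u * (a0 \<bullet> u)\<close>. The square root is the tangent of the angle
  between \<open>a\<close> and \<open>u\<close>, which decreases in \<open>a \<bullet> u\<close>, so
  \<open>a0\<close> also gives the largest value.\<close>

lemma q_fun_unit_normals:
  assumes "convex_body K" "norm u = 1"
  shows q_fun_ge: "\<And>a. a \<in> unit_normals K u \<Longrightarrow>
      max_chord K u * sqrt (1 / (a \<bullet> u)\<^sup>2 - 1) \<le> q_fun K u"
    and q_fun_attained: "\<exists>a\<in>unit_normals K u. q_fun K u = max_chord K u * sqrt (1 / (a \<bullet> u)\<^sup>2 - 1)"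
proof -
  let ?d = "max_chord K u"
  have dpos: "?d > 0"
    using max_chord_pos assms by blast
  obtain a0 where a0: "a0 \<in> unit_normals K u" "\<And>a. a \<in> unit_normals K u \<Longrightarrow> a0 \<bullet> u \<le> a \<bullet> u"
    using continuous_attains_inf[OF compact_unit_normals unit_normals_nonempty[OF assms], of "\<lambda>a. a \<bullet> u"]
      continuous_on_inner[OF continuous_on_id continuous_on_const] by blast
  have "r_fun K u = ?d * (a0 \<bullet> u)"
    unfolding r_fun_eq_Inf[OF assms]
    using a0 dpos by (intro cInf_eq_minimum) auto
  then have q: "q_fun K u = ?d * sqrt (1 / (a0 \<bullet> u)\<^sup>2 - 1)"
    using dpos by (simp add: q_fun_def power_mult_distrib)
  show "\<exists>a\<in>unit_normals K u. q_fun K u = ?d * sqrt (1 / (a \<bullet> u)\<^sup>2 - 1)"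
    using q a0 by blast
  fix a assume a: "a \<in> unit_normals K u"
  have "0 < a0 \<bullet> u" "a0 \<bullet> u \<le> a \<bullet> u"
    using unit_normals_pos assms a0 a by blast+
  then have "1 / (a \<bullet> u)\<^sup>2 \<le> 1 / (a0 \<bullet> u)\<^sup>2"
    by (intro divide_left_mono power_mono mult_pos_pos zero_less_power) auto
  then show "?d * sqrt (1 / (a \<bullet> u)\<^sup>2 - 1) \<le> q_fun K u"
    using dpos by (simp add: q)
qed

section \<open>Quadratic estimate for the maximal chord length\<close>

lemma one_minus_cos_le: "1 - cos (x::real) \<le> x\<^sup>2 / 2"
proof -
  have "(sin (x / 2))\<^sup>2 \<le> (x / 2)\<^sup>2"
    using abs_sin_x_le_abs_x[of "x / 2"] by (rule abs_le_square_iff[THEN iffD1])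
  then show ?thesis
    using cos_double_sin[of "x / 2"] by (simp add: power_divide)
qed

text \<open>This is the spherical triangle inequality in the form cos(angle of a, u) \<ge> cos(angle
  of a, v + angle of u, v): split \<open>a\<close> and \<open>u\<close> along \<open>v\<close> and
  apply Cauchy-Schwarz to the parts orthogonal to \<open>v\<close>.\<close>

lemma inner_tilt_ge:
  fixes a u v :: "'a::euclidean_space"
  assumes "norm a = 1" "norm u = 1" "norm v = 1"
  shows "a \<bullet> u \<ge> (u \<bullet> v) * (a \<bullet> v) - sqrt (1 - (a \<bullet> v)\<^sup>2) * sqrt (1 - (u \<bullet> v)\<^sup>2)"
proof -
  have self: "x \<bullet> x = 1" if "norm x = 1" for x :: 'a
    using that by (simp add: dot_square_norm)
  have nrm: "norm (x - (x \<bullet> v) *\<^sub>R v) = sqrt (1 - (x \<bullet> v)\<^sup>2)" if "norm x = 1" for x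
    using self[OF that] self[OF assms(3)]
    by (simp add: norm_eq_sqrt_inner inner_diff_left inner_diff_right inner_commute
        power2_eq_square)
  have "(a - (a \<bullet> v) *\<^sub>R v) \<bullet> (u - (u \<bullet> v) *\<^sub>R v) = a \<bullet> u - (u \<bullet> v) * (a \<bullet> v)"
    using self[OF assms(3)] by (simp add: inner_diff_left inner_diff_right inner_commute[of v u])
  then have "\<bar>a \<bullet> u - (u \<bullet> v) * (a \<bullet> v)\<bar> \<le> sqrt (1 - (a \<bullet> v)\<^sup>2) * sqrt (1 - (u \<bullet> v)\<^sup>2)"
    using Cauchy_Schwarz_ineq2[of "a - (a \<bullet> v) *\<^sub>R v" "u - (u \<bullet> v) *\<^sub>R v"] nrm assms by simp
  then show ?thesis by linarith
qed

text \<open>Take a normal \<open>a\<close> at \<open>v\<close> attaining \<open>q_fun K v\<close>.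
  The boundary point in direction \<open>u\<close> satisfies its supporting inequality; bound
  \<open>a \<bullet> u\<close> below by \<open>inner_tilt_ge\<close> and divide by
  \<open>a \<bullet> v\<close>.\<close>

lemma max_chord_tilt:
  fixes u v :: "'a::euclidean_space"
  assumes "convex_body K" "norm u = 1" "norm v = 1"
  shows "max_chord K u * (u \<bullet> v - sqrt (1 - (u \<bullet> v)\<^sup>2) * (q_fun K v / max_chord K v)) \<le> max_chord K v"
proof -
  let ?du = "max_chord K u" and ?dv = "max_chord K v" and ?c = "u \<bullet> v"
  obtain a where a: "a \<in> unit_normals K v" "q_fun K v = ?dv * sqrt (1 / (a \<bullet> v)\<^sup>2 - 1)"
    using q_fun_attained[of K v] assms by blast
  \<comment> \<open>\<open>T\<close> is the tangent of the angle between \<open>a\<close> and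
    \<open>v\<close>, so multiplying it by the cosine \<open>a \<bullet> v\<close> gives the
    sine.\<close>
  define T where "T = q_fun K v / ?dv"
  have dpos: "?du > 0" "?dv > 0"
    using max_chord_pos assms by blast+
  have pos: "a \<bullet> v > 0" and na: "norm a = 1"
    using unit_normals_pos a assms by (auto simp: unit_normals_def)
  have "(a \<bullet> v) * T = sqrt ((a \<bullet> v)\<^sup>2) * sqrt (1 / (a \<bullet> v)\<^sup>2 - 1)"
    using a(2) dpos pos by (simp add: T_def)
  also have "\<dots> = sqrt (1 - (a \<bullet> v)\<^sup>2)"
    using pos by (simp only: real_sqrt_mult[symmetric]) (simp add: right_diff_distrib)
  finally have T: "(a \<bullet> v) * T = sqrt (1 - (a \<bullet> v)\<^sup>2)" .
  have "(a \<bullet> v) * (?du * (?c - sqrt (1 - ?c\<^sup>2) * T)) =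
      ?du * (?c * (a \<bullet> v) - ((a \<bullet> v) * T) * sqrt (1 - ?c\<^sup>2))"
    by (simp add: algebra_simps)
  also have "\<dots> \<le> ?du * (a \<bullet> u)"
    using inner_tilt_ge[OF na assms(2,3)] dpos by (intro mult_left_mono) (auto simp: T)
  also have "\<dots> = a \<bullet> (?du *\<^sub>R u)" by simp
  also have "\<dots> \<le> ?dv * (a \<bullet> v)"
    using a max_chord_mem[OF assms(1,2)] unfolding unit_normals_def by blast
  finally have "(a \<bullet> v) * (?du * (?c - sqrt (1 - ?c\<^sup>2) * T)) \<le> (a \<bullet> v) * ?dv"
    by (simp add: mult.commute)
  with pos have "?du * (?c - sqrt (1 - ?c\<^sup>2) * T) \<le> ?dv"
    by simp
  then show ?thesis by (simp add: T_def)
qed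

lemma max_chord_bounds:
  fixes K :: "'a::euclidean_space set"
  assumes "convex_body K"
  obtains e R where "0 < e" "\<And>u. norm u = 1 \<Longrightarrow> e \<le> max_chord K u"
    "\<And>u. norm u = 1 \<Longrightarrow> max_chord K u \<le> R"
    "\<And>u a. norm u = 1 \<Longrightarrow> a \<in> unit_normals K u \<Longrightarrow> e \<le> max_chord K u * (a \<bullet> u)"
proof -
  obtain e where e: "0 < e" "cball 0 e \<subseteq> diff_body K"
    using diff_body_contains_cball assms by blast
  obtain R where R: "\<And>x. x \<in> diff_body K \<Longrightarrow> norm x \<le> R"
    using compact_imp_bounded[OF compact_diff_body[OF assms]] by (auto simp: bounded_iff)
  show ?thesis
  proof (rule that[of e R])
    fix u :: 'a assume u: "norm u = 1"
    have "e *\<^sub>R u \<in> diff_body K"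
      using e u by (intro subsetD[OF e(2)]) auto
    then show "e \<le> max_chord K u"
      using max_chord_max[OF assms u] by fastforce
    show "max_chord K u \<le> R"
      using R[OF max_chord_mem[OF assms u]] max_chord_pos[OF assms u] u by simp
    show "e \<le> max_chord K u * (a \<bullet> u)" if "a \<in> unit_normals K u" for a
      using unit_normals_lower that e by blast
  qed (use e in auto)
qed

lemma q_fun_bounded:
  assumes "convex_body K"
  obtains M where "\<And>u. norm u = 1 \<Longrightarrow> 0 \<le> q_fun K u \<and> q_fun K u \<le> M"
proof -
  obtain e R where eR: "0 < e" "\<And>u. norm u = 1 \<Longrightarrow> e \<le> max_chord K u"
    "\<And>u. norm u = 1 \<Longrightarrow> max_chord K u \<le> R"
    "\<And>u a. norm u = 1 \<Longrightarrow> a \<in> unit_normals K u \<Longrightarrow> e \<le> max_chord K u * (a \<bullet> u)"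
    using max_chord_bounds[OF assms] by blast
  have "0 \<le> q_fun K u \<and> q_fun K u \<le> R * (R / e)" if u: "norm u = 1" for u
  proof -
    let ?d = "max_chord K u"
    obtain a where a: "a \<in> unit_normals K u" "q_fun K u = ?d * sqrt (1 / (a \<bullet> u)\<^sup>2 - 1)"
      using q_fun_attained[of K u] assms u by blast
    note pos = unit_normals_pos[OF assms u a(1)]
    have "a \<bullet> u \<le> 1"
      using norm_cauchy_schwarz[of a u] a(1) u by (simp add: unit_normals_def)
    then have le1: "(a \<bullet> u)\<^sup>2 \<le> 1"
      using pos by (simp add: power_le_one)
    \<comment> \<open>The tangent is at most the secant, and the cosine \<open>a \<bullet> u\<close>
      is at least \<open>e / R\<close>.\<close>
    have "sqrt (1 / (a \<bullet> u)\<^sup>2 - 1) \<le> sqrt ((1 / (a \<bullet> u))\<^sup>2)"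
      by (intro real_sqrt_le_mono) (simp add: power_divide)
    also have "\<dots> = 1 / (a \<bullet> u)" using pos by simp
    also have "\<dots> \<le> R / e"
    proof -
      have "e \<le> R * (a \<bullet> u)"
        using eR(4)[OF u a(1)] mult_right_mono[OF eR(3)[OF u], of "a \<bullet> u"] pos by linarith
      with pos eR(1) show ?thesis by (simp add: field_simps)
    qed
    finally have "sqrt (1 / (a \<bullet> u)\<^sup>2 - 1) \<le> R / e" .
    moreover have "0 \<le> sqrt (1 / (a \<bullet> u)\<^sup>2 - 1)"
      using le1 pos by simp
    ultimately show ?thesis
      unfolding a(2) using eR(1) eR(2,3)[OF u] by (intro conjI mult_mono mult_nonneg_nonneg) linarith+
  qed
  with that show ?thesis by blast
qed

text \<open>\<open>max_chord_tilt\<close> bounds the increment by a cosine error plus sin \<phi>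
  times \<open>k * q_fun K v\<close>, where \<open>k\<close> is the ratio of the two lengths. A
  crude Lipschitz bound shows that \<open>k\<close> exceeds 1 by at most a multiple of \<phi>, which
  moves the excess into the quadratic term.\<close>

lemma max_chord_quadratic_estimate:
  fixes K :: "'a::euclidean_space set"
  assumes "convex_body K"
  obtains C where "C \<ge> 0"
    "\<And>u v. norm u = 1 \<Longrightarrow> norm v = 1 \<Longrightarrow>
       \<bar>max_chord K u - max_chord K v\<bar> \<le> rho u v * max (q_fun K u) (q_fun K v) + C * (rho u v)\<^sup>2"
proof -
  let ?d = "max_chord K"
  obtain e R where eR: "0 < e" "\<And>u. norm u = 1 \<Longrightarrow> e \<le> max_chord K u"
    "\<And>u. norm u = 1 \<Longrightarrow> max_chord K u \<le> R"
    "\<And>u a. norm u = 1 \<Longrightarrow> a \<in> unit_normals K u \<Longrightarrow> e \<le> max_chord K u * (a \<bullet> u)"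
    using max_chord_bounds[OF assms] by blast
  obtain M where M: "\<And>u. norm u = 1 \<Longrightarrow> 0 \<le> q_fun K u \<and> q_fun K u \<le> M"
    using q_fun_bounded[OF assms] by blast
  obtain b :: 'a where b: "norm b = 1"
    using vector_choose_size[of 1] by auto
  have M0: "0 \<le> M" and R0: "0 < R"
    using M[OF b] eR(1) eR(2,3)[OF b] by linarith+
  \<comment> \<open>\<open>C1\<close> is the crude Lipschitz constant obtained from
    \<open>k \<le> R / e\<close>. In \<open>C\<close>, the first summand pays for 1 - cos \<phi> and
    the second for replacing \<open>k\<close> by 1.\<close>
  define C1 where "C1 = R + R / e * M"
  define C where "C = R / 2 + C1 / e * M"
  have C10: "C1 \<ge> 0"
    using M0 R0 eR(1) by (simp add: C1_def)
  then have C0: "C \<ge> 0"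
    using M0 R0 eR(1) by (simp add: C_def)
  have one_sided: "?d u - ?d v \<le> rho u v * q_fun K v + C * (rho u v)\<^sup>2"
    if u: "norm u = 1" and v: "norm v = 1" and c: "u \<bullet> v \<ge> 0" for u v
  proof (cases "?d u \<le> ?d v")
    case True
    have "\<bar>u \<bullet> v\<bar> \<le> 1"
      using Cauchy_Schwarz_ineq2[of u v] u v by simp
    then have "rho u v \<ge> 0"
      by (simp add: rho_def arccos_lbound)
    then have "0 \<le> rho u v * q_fun K v + C * (rho u v)\<^sup>2"
      using C0 M[OF v] by simp
    with True show ?thesis by linarith
  next
    case False
    define \<phi> where "\<phi> = rho u v"
    have c1: "u \<bullet> v \<le> 1"
      using norm_cauchy_schwarz[of u v] u v by simp
    have cos: "cos \<phi> = u \<bullet> v" and sin: "sin \<phi> = sqrt (1 - (u \<bullet> v)\<^sup>2)"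
      using c c1 by (auto simp: \<phi>_def rho_def sin_arccos)
    have \<phi>: "0 \<le> \<phi>" "\<phi> \<le> 2"
    proof -
      show "0 \<le> \<phi>" using c c1 by (simp add: \<phi>_def rho_def arccos_lbound)
      have "\<phi> \<le> pi / 2" using c c1 arccos_le_pi2[of "u \<bullet> v"] by (simp add: \<phi>_def rho_def)
      then show "\<phi> \<le> 2" using pi_half_less_two by linarith
    qed
    have q: "0 \<le> q_fun K v" "q_fun K v \<le> M" using M[OF v] by auto
    have d: "e \<le> ?d u" "?d u \<le> R" "e \<le> ?d v" using eR u v by auto
    define k where "k = ?d u / ?d v"
    have k: "0 \<le> k" "k \<le> R / e"
      using d eR(1) unfolding k_def by (auto intro!: frac_le)
    have "?d u * (cos \<phi> - sin \<phi> * (q_fun K v / ?d v)) \<le> ?d v"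
      using max_chord_tilt[OF assms u v] by (simp add: cos sin)
    then have "?d u - ?d v \<le> ?d u * (1 - cos \<phi>) + sin \<phi> * (k * q_fun K v)"
      by (simp add: k_def algebra_simps)
    also have "\<dots> \<le> R * (\<phi>\<^sup>2 / 2) + \<phi> * (k * q_fun K v)"
    proof -
      have "?d u * (1 - cos \<phi>) \<le> R * (\<phi>\<^sup>2 / 2)"
        using d eR(1) R0 one_minus_cos_le[of \<phi>] by (intro mult_mono) auto
      moreover have "sin \<phi> * (k * q_fun K v) \<le> \<phi> * (k * q_fun K v)"
        using sin_x_le_x[OF \<phi>(1)] k q by (intro mult_right_mono) auto
      ultimately show ?thesis by linarith
    qed
    finally have main: "?d u - ?d v \<le> R * (\<phi>\<^sup>2 / 2) + \<phi> * (k * q_fun K v)" .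
    \<comment> \<open>Here \<phi> \<le> 2 turns the quadratic term into a linear one.\<close>
    have "R * (\<phi>\<^sup>2 / 2) \<le> R * \<phi>"
      using \<phi> R0 mult_left_mono[of \<phi> 2 \<phi>] by (intro mult_left_mono) (auto simp: power2_eq_square)
    moreover have "\<phi> * (k * q_fun K v) \<le> \<phi> * (R / e * M)"
      using \<phi> k q by (intro mult_left_mono mult_mono) auto
    ultimately have crude: "?d u - ?d v \<le> C1 * \<phi>"
      using main by (simp add: C1_def algebra_simps)
    \<comment> \<open>The crude bound is fed back to improve the constant bound on
      \<open>k\<close>.\<close>
    have "k = 1 + (?d u - ?d v) / ?d v"
      using d eR(1) by (simp add: k_def field_simps)
    also have "\<dots> \<le> 1 + C1 * \<phi> / e"
      using d eR(1) crude C10 \<phi> False by (intro add_left_mono frac_le) auto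
    finally have "k * q_fun K v \<le> (1 + C1 * \<phi> / e) * q_fun K v"
      using q by (intro mult_right_mono) auto
    also have "\<dots> \<le> q_fun K v + C1 * \<phi> / e * M"
      using mult_left_mono[OF q(2), of "C1 * \<phi> / e"] C10 \<phi> eR(1) by (simp add: algebra_simps)
    finally have "\<phi> * (k * q_fun K v) \<le> \<phi> * (q_fun K v + C1 * \<phi> / e * M)"
      using \<phi> by (intro mult_left_mono) auto
    with main have "?d u - ?d v \<le> \<phi> * q_fun K v + C * \<phi>\<^sup>2"
      by (simp add: C_def algebra_simps power2_eq_square)
    then show ?thesis by (simp add: \<phi>_def)
  qed
  \<comment> \<open>For an obtuse pair replace \<open>u\<close> by \<open>- u\<close>, which changes
    neither \<open>rho\<close> nor the chord length.\<close>
  have one_sided': "?d u - ?d v \<le> rho u v * q_fun K v + C * (rho u v)\<^sup>2"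
    if u: "norm u = 1" and v: "norm v = 1" for u v
  proof (cases "u \<bullet> v \<ge> 0")
    case True
    with one_sided u v show ?thesis by blast
  next
    case False
    moreover have "rho (- u) v = rho u v" by (simp add: rho_def)
    ultimately show ?thesis
      using one_sided[of "- u" v] u v max_chord_uminus[OF assms u] by simp
  qed
  have "\<bar>?d u - ?d v\<bar> \<le> rho u v * max (q_fun K u) (q_fun K v) + C * (rho u v)\<^sup>2"
    if u: "norm u = 1" and v: "norm v = 1" for u v
  proof -
    have "\<bar>u \<bullet> v\<bar> \<le> 1"
      using Cauchy_Schwarz_ineq2[of u v] u v by simp
    then have "rho u v \<ge> 0"
      by (simp add: rho_def arccos_lbound)
    then have "rho u v * q_fun K v \<le> rho u v * max (q_fun K u) (q_fun K v)"
      "rho u v * q_fun K u \<le> rho u v * max (q_fun K u) (q_fun K v)"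
      by (auto intro: mult_left_mono)
    moreover have "rho v u = rho u v"
      by (simp add: rho_def inner_commute)
    ultimately show ?thesis
      using one_sided'[OF u v] one_sided'[OF v u] by (simp add: abs_le_iff)
  qed
  with that C0 show ?thesis by blast
qed

section \<open>Upper semicontinuity of q and its maximum\<close>

text \<open>Encoding the graph of the normal map by triples (direction, length, normal) makes it closed
  without appeal to continuity of the maximal chord length: in such a triple the length is forced.\<close>

lemma compact_normal_graph:
  fixes K :: "'a::euclidean_space set"
  assumes "convex_body K"
  shows "compact {(v, max_chord K v, a) | v a. norm v = 1 \<and> a \<in> unit_normals K v}" (is "compact ?T")
proof -
  obtain e R where eR: "0 < e" "\<And>u. norm u = 1 \<Longrightarrow> e \<le> max_chord K u"
    "\<And>u. norm u = 1 \<Longrightarrow> max_chord K u \<le> R"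
    "\<And>u a. norm u = 1 \<Longrightarrow> a \<in> unit_normals K u \<Longrightarrow> e \<le> max_chord K u * (a \<bullet> u)"
    using max_chord_bounds[OF assms] by blast
  obtain r where r: "0 < r" "cball 0 r \<subseteq> diff_body K"
    using diff_body_contains_cball assms by blast
  define S :: "('a \<times> real \<times> 'a) set" where
    "S = (sphere 0 1 \<times> {0..R} \<times> sphere 0 1) \<inter> (\<lambda>p. fst (snd p) *\<^sub>R fst p) -` diff_body K \<inter>
         (\<Inter>x\<in>diff_body K. {p. snd (snd p) \<bullet> x \<le> fst (snd p) * (snd (snd p) \<bullet> fst p)})"
  have "compact S"
    unfolding S_def
    by (intro compact_Int_closed compact_Times compact_sphere compact_Icc closed_INT ballI
        closed_Collect_le closed_vimage compact_imp_closed compact_diff_body assms continuous_intros)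
  moreover have "S = ?T"
  proof (intro equalityI subsetI)
    fix p assume "p \<in> S"
    obtain v t a where p: "p = (v, t, a)" by (cases p)
    with \<open>p \<in> S\<close> have S: "norm v = 1" "0 \<le> t" "norm a = 1" "t *\<^sub>R v \<in> diff_body K"
      "\<And>x. x \<in> diff_body K \<Longrightarrow> a \<bullet> x \<le> t * (a \<bullet> v)"
      by (auto simp: S_def)
    \<comment> \<open>Testing at \<open>r *\<^sub>R a\<close> gives
      \<open>0 < a \<bullet> v\<close>. This factor can then be cancelled in the inequality at the
      boundary point, so \<open>t\<close> is at least the maximal length; membership of
      \<open>t *\<^sub>R v\<close> gives the converse.\<close>
    have "r *\<^sub>R a \<in> diff_body K"
      using r S by (intro subsetD[OF r(2)]) auto
    from S(5)[OF this] have "0 < t * (a \<bullet> v)"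
      using r S(3) by (simp add: dot_square_norm)
    then have "0 < a \<bullet> v"
      using S(2) by (simp add: zero_less_mult_iff)
    moreover have "max_chord K v * (a \<bullet> v) \<le> t * (a \<bullet> v)"
      using S(5)[OF max_chord_mem[OF assms S(1)]] by simp
    ultimately have "t = max_chord K v"
      using max_chord_max[OF assms S(1,4)] by simp
    then show "p \<in> ?T"
      using S p by (auto simp: unit_normals_def)
  next
    fix p assume "p \<in> ?T"
    then obtain v a where p: "p = (v, max_chord K v, a)" "norm v = 1" "a \<in> unit_normals K v"
      by blast
    then show "p \<in> S"
      using max_chord_mem[OF assms p(2)] max_chord_pos[OF assms p(2)] eR(3)[OF p(2)]
      by (auto simp: S_def unit_normals_def)
  qed
  ultimately show ?thesis by simp
qed

text \<open>This is upper semicontinuity of \<open>q_fun K\<close> on the sphere. As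
  \<open>q_fun\<close> is a maximum over normals, its superlevel set is the projection of the
  compact part of the normal graph where the continuous function \<open>f\<close> is at least
  \<open>c\<close>.\<close>

lemma compact_q_fun_superlevel:
  fixes K :: "'a::euclidean_space set"
  assumes "convex_body K"
  shows "compact {v. norm v = 1 \<and> c \<le> q_fun K v}"
proof -
  define T where "T = {(v, max_chord K v, a) | v a. norm v = 1 \<and> a \<in> unit_normals K v}"
  define f :: "'a \<times> real \<times> 'a \<Rightarrow> real" where
    "f p = fst (snd p) * sqrt (1 / (snd (snd p) \<bullet> fst p)\<^sup>2 - 1)" for p
  have T: "compact T"
    unfolding T_def by (rule compact_normal_graph[OF assms])
  have "snd (snd p) \<bullet> fst p \<noteq> 0" if "p \<in> T" for p
    using that unit_normals_pos[OF assms] by (fastforce simp: T_def)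
  then have "continuous_on T f"
    unfolding f_def by (intro continuous_intros) auto
  then have "closed (T \<inter> f -` {c..})"
    using T by (intro continuous_closed_preimage) (auto intro: compact_imp_closed)
  with T have "compact (T \<inter> (T \<inter> f -` {c..}))"
    by (rule compact_Int_closed)
  then have "compact (fst ` (T \<inter> (T \<inter> f -` {c..})))"
    by (intro compact_continuous_image continuous_intros)
  also have "fst ` (T \<inter> (T \<inter> f -` {c..})) = {v. norm v = 1 \<and> c \<le> q_fun K v}"
  proof (intro equalityI subsetI)
    fix v assume "v \<in> fst ` (T \<inter> (T \<inter> f -` {c..}))"
    then obtain a where a: "norm v = 1" "a \<in> unit_normals K v"
      "c \<le> max_chord K v * sqrt (1 / (a \<bullet> v)\<^sup>2 - 1)"
      by (auto simp: T_def f_def)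
    then show "v \<in> {v. norm v = 1 \<and> c \<le> q_fun K v}"
      using q_fun_ge[OF assms a(1,2)] by simp
  next
    fix v assume "v \<in> {v. norm v = 1 \<and> c \<le> q_fun K v}"
    then have v: "norm v = 1" "c \<le> q_fun K v" by auto
    then obtain a where a: "a \<in> unit_normals K v"
      "q_fun K v = max_chord K v * sqrt (1 / (a \<bullet> v)\<^sup>2 - 1)"
      using q_fun_attained[of K v] assms by blast
    have "(v, max_chord K v, a) \<in> T \<inter> (T \<inter> f -` {c..})"
      using v a by (simp add: T_def f_def)
    then show "v \<in> fst ` (T \<inter> (T \<inter> f -` {c..}))" by force
  qed
  finally show ?thesis .
qed

text \<open>The \<open>GREATEST\<close> in \<open>N_hat\<close> must be shown to be attained. The
  compact superlevel sets \<open>F w\<close> have the finite intersection property, and a common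
  point of all of them is a maximiser.\<close>

lemma q_fun_le_N_hat:
  fixes K :: "'a::euclidean_space set"
  assumes "convex_body K" "norm u = 1"
  shows "q_fun K u \<le> N_hat K"
proof -
  define F where "F w = {v. norm v = 1 \<and> q_fun K w \<le> q_fun K v}" for w
  have "sphere 0 1 \<inter> \<Inter> (F ` sphere 0 1) \<noteq> {}"
  proof (rule compact_imp_fip_image)
    show "compact (sphere (0::'a) 1)" by simp
    show "closed (F w)" if "w \<in> sphere 0 1" for w
      unfolding F_def by (intro compact_imp_closed compact_q_fun_superlevel assms)
    fix I assume I: "finite I" "I \<subseteq> sphere (0::'a) 1"
    show "sphere 0 1 \<inter> \<Inter> (F ` I) \<noteq> {}"
    proof (cases "I = {}")
      case True
      then show ?thesis using assms by (auto intro!: exI[of _ u])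
    next
      case False
      then obtain w where "w \<in> I" "q_fun K w = Max (q_fun K ` I)"
        using I Max_in[of "q_fun K ` I"] by fastforce
      then have "w \<in> sphere 0 1 \<inter> \<Inter> (F ` I)"
        using I by (auto simp: F_def)
      then show ?thesis by blast
    qed
  qed
  then obtain w where w: "norm w = 1" "\<And>v. norm v = 1 \<Longrightarrow> q_fun K v \<le> q_fun K w"
    by (force simp: F_def)
  have "N_hat K = q_fun K w"
    unfolding N_hat_def using w assms by (intro Greatest_equality) auto
  with w assms show ?thesis by simp
qed

section \<open>The global Lipschitz bound\<close>

text \<open>Subdividing the interval into \<open>m\<close> pieces divides the quadratic error by \<open>m\<close>.\<close>

lemma lipschitz_from_quadratic_error:
  fixes g :: "real \<Rightarrow> real"
  assumes "0 \<le> L"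
    and g: "\<And>s t. s \<in> {0..L} \<Longrightarrow> t \<in> {0..L} \<Longrightarrow> \<bar>g s - g t\<bar> \<le> N * \<bar>s - t\<bar> + C * (s - t)\<^sup>2"
  shows "\<bar>g L - g 0\<bar> \<le> N * L"
proof -
  \<comment> \<open>Using \<open>Suc m\<close> pieces keeps the divisor positive for every
    \<open>m\<close>.\<close>
  have bound: "\<bar>g L - g 0\<bar> \<le> N * L + C * L\<^sup>2 / real (Suc m)" for m
  proof -
    define h where "h = L / real (Suc m)"
    have h: "0 \<le> h" "real (Suc m) * h = L"
      using assms(1) by (auto simp: h_def)
    have "\<bar>g (real k * h) - g 0\<bar> \<le> real k * (N * h + C * h\<^sup>2)" if "k \<le> Suc m" for k
      using that
    proof (induction k)
      case (Suc k)
      have in_I: "real j * h \<in> {0..L}" if "j \<le> Suc m" for j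
        using that h mult_right_mono[of "real j" "real (Suc m)" h] by auto
      have "\<bar>g (real (Suc k) * h) - g (real k * h)\<bar> \<le> N * h + C * h\<^sup>2"
        using g[OF in_I[of "Suc k"] in_I[of k]] Suc.prems h by (simp add: algebra_simps)
      with Suc show ?case by (simp add: algebra_simps)
    qed simp
    from this[of "Suc m"] have "\<bar>g L - g 0\<bar> \<le> real (Suc m) * (N * h + C * h\<^sup>2)"
      by (metis h(2) order_refl)
    also have "\<dots> = N * (real (Suc m) * h) + C * (real (Suc m) * h) * h"
      by (simp add: algebra_simps power2_eq_square del: of_nat_Suc)
    also have "\<dots> = N * L + C * L\<^sup>2 / real (Suc m)"
      by (simp only: h(2)) (simp add: h_def power2_eq_square)
    finally show ?thesis .
  qed
  have "(\<lambda>m. N * L + C * L\<^sup>2 / real (Suc m)) \<longlonglongrightarrow> N * L + 0"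
    by (intro tendsto_add tendsto_const LIMSEQ_Suc lim_const_over_n)
  then show ?thesis
    using bound by (intro LIMSEQ_le_const[of _ "N * L"]) auto
qed

lemma max_chord_lipschitz:
  fixes u v :: "'a::euclidean_space"
  assumes "convex_body K" "norm u = 1" "norm v = 1"
  shows "\<bar>max_chord K u - max_chord K v\<bar> \<le> N_hat K * rho u v"
proof -
  obtain C where C: "C \<ge> 0"
    "\<And>u v. norm u = 1 \<Longrightarrow> norm v = 1 \<Longrightarrow>
       \<bar>max_chord K u - max_chord K v\<bar> \<le> rho u v * max (q_fun K u) (q_fun K v) + C * (rho u v)\<^sup>2"
    using max_chord_quadratic_estimate[OF assms(1)] by blast
  have acute: "\<bar>max_chord K u - max_chord K v\<bar> \<le> N_hat K * rho u v"
    if u: "norm u = 1" and v: "norm v = 1" and c: "u \<bullet> v \<ge> 0" for u v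
  \<comment> \<open>Coinciding vectors are treated apart because \<open>w\<close> below divides by
    sin \<phi>.\<close>
  proof (cases "u \<bullet> v = 1")
    case True
    then have "rho u v = 0" by (simp add: rho_def)
    with C(2)[OF u v] show ?thesis by simp
  next
    case False
    define \<phi> where "\<phi> = rho u v"
    have c1: "u \<bullet> v < 1"
      using norm_cauchy_schwarz[of u v] u v False by simp
    have cos: "cos \<phi> = u \<bullet> v" and sin: "sin \<phi> = sqrt (1 - (u \<bullet> v)\<^sup>2)"
      using c c1 by (auto simp: \<phi>_def rho_def sin_arccos)
    have \<phi>: "0 \<le> \<phi>" "\<phi> \<le> pi / 2"
      using c c1 arccos_le_pi2[of "u \<bullet> v"] by (simp_all add: \<phi>_def rho_def arccos_lbound)
    have "(u \<bullet> v)\<^sup>2 < 1"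
      using c c1 by (simp add: power_less_one_iff)
    then have s0: "sin \<phi> > 0" by (simp add: sin)
    \<comment> \<open>Gram-Schmidt: \<open>w\<close> is the unit vector orthogonal to
      \<open>v\<close> in the plane of \<open>u\<close> and \<open>v\<close>, so \<gamma> runs along
      the great circle from \<open>v\<close> at 0 to \<open>u\<close> at \<phi>.\<close>
    define w where "w = (1 / sin \<phi>) *\<^sub>R (u - cos \<phi> *\<^sub>R v)"
    define \<gamma> where "\<gamma> t = cos t *\<^sub>R v + sin t *\<^sub>R w" for t
    have uu: "u \<bullet> u = 1" and vv: "v \<bullet> v = 1"
      using u v by (auto simp: dot_square_norm)
    have vw: "v \<bullet> w = 0"
      by (simp add: w_def inner_diff_right vv cos inner_commute[of v u])
    have "(u - cos \<phi> *\<^sub>R v) \<bullet> (u - cos \<phi> *\<^sub>R v) = 1 - (cos \<phi>)\<^sup>2"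
      by (simp add: inner_diff_left inner_diff_right uu vv cos inner_commute[of v u] power2_eq_square)
    then have ww: "w \<bullet> w = 1"
      using s0 by (simp add: w_def flip: sin_squared_eq) (simp add: power2_eq_square)
    have inner: "\<gamma> s \<bullet> \<gamma> t = cos (s - t)" for s t
      by (simp add: \<gamma>_def inner_add_left inner_add_right vv ww vw inner_commute[of w v] cos_diff)
    have unit: "norm (\<gamma> t) = 1" for t
      using inner[of t t] by (simp add: norm_eq_sqrt_inner)
    \<comment> \<open>The arc is no longer than a right angle, so the absolute value in
      \<open>rho\<close> has no effect along it.\<close>
    have rho: "rho (\<gamma> s) (\<gamma> t) = \<bar>s - t\<bar>" if "s \<in> {0..\<phi>}" "t \<in> {0..\<phi>}" for s t
    proof -
      have st: "\<bar>s - t\<bar> \<le> pi / 2" using that \<phi> unfolding atLeastAtMost_iff by linarith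
      then have "cos (s - t) \<ge> 0" unfolding abs_le_iff by (intro cos_ge_zero) linarith+
      moreover have "\<bar>s - t\<bar> \<le> pi"
        using st pi_ge_zero by linarith
      ultimately show ?thesis
        using arccos_cos_eq_abs[of "s - t"] by (simp add: rho_def inner)
    qed
    have "\<bar>max_chord K (\<gamma> \<phi>) - max_chord K (\<gamma> 0)\<bar> \<le> N_hat K * \<phi>"
    proof (rule lipschitz_from_quadratic_error)
      fix s t assume st: "s \<in> {0..\<phi>}" "t \<in> {0..\<phi>}"
      have "\<bar>s - t\<bar> * max (q_fun K (\<gamma> s)) (q_fun K (\<gamma> t)) \<le> \<bar>s - t\<bar> * N_hat K"
        using q_fun_le_N_hat[OF assms(1) unit] by (intro mult_left_mono) auto
      then show "\<bar>max_chord K (\<gamma> s) - max_chord K (\<gamma> t)\<bar> \<le> N_hat K * \<bar>s - t\<bar> + C * (s - t)\<^sup>2"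
        using C(2)[OF unit[of s] unit[of t]] by (simp add: rho[OF st] mult.commute)
    qed (rule \<phi>(1))
    moreover have "\<gamma> \<phi> = u" "\<gamma> 0 = v"
      using s0 by (auto simp: \<gamma>_def w_def)
    ultimately show ?thesis by (simp add: \<phi>_def)
  qed
  show ?thesis
  proof (cases "u \<bullet> v \<ge> 0")
    case True
    with acute assms show ?thesis by blast
  next
    case False
    moreover have "rho (- u) v = rho u v" by (simp add: rho_def)
    ultimately show ?thesis
      using acute[of "- u" v] assms max_chord_uminus[OF assms(1,2)] by simp
  qed
qed

section \<open>The upper limit of the difference quotients\<close>

lemma rho_pos:
  assumes "(u, v) \<in> direction_pairs"
  shows "rho u v > 0"
proof -
  have uv: "norm u = 1" "norm v = 1" "u \<noteq> v" "u \<noteq> - v"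
    using assms by (auto simp: direction_pairs_def)
  have "\<bar>u \<bullet> v\<bar> \<le> 1"
    using Cauchy_Schwarz_ineq2[of u v] uv by simp
  moreover have "\<bar>u \<bullet> v\<bar> \<noteq> 1"
    using uv norm_cauchy_schwarz_abs_eq[of u v] by auto
  ultimately show ?thesis
    using arccos_lt_bounded[of "\<bar>u \<bullet> v\<bar>"] by (simp add: rho_def)
qed

lemma rho_tendsto_zero:
  assumes "norm (u::'a::euclidean_space) = 1"
  shows "((\<lambda>p. rho (fst p) (snd p)) \<longlongrightarrow> 0) (at (u, u) within direction_pairs)"
proof -
  have "continuous_on (sphere (0::'a) 1 \<times> sphere 0 1) (\<lambda>p. rho (fst p) (snd p))"
    unfolding rho_def
  proof (intro continuous_intros ballI)
    fix p :: "'a \<times> 'a" assume p: "p \<in> sphere 0 1 \<times> sphere 0 1"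
    show "- 1 \<le> \<bar>fst p \<bullet> snd p\<bar> \<and> \<bar>fst p \<bullet> snd p\<bar> \<le> 1"
      using Cauchy_Schwarz_ineq2[of "fst p" "snd p"] p by auto
  qed
  then have "((\<lambda>p. rho (fst p) (snd p)) \<longlongrightarrow> rho u u) (at (u, u) within sphere 0 1 \<times> sphere 0 1)"
    using assms by (force simp: continuous_on_def)
  moreover have "rho u u = 0"
    using assms by (simp add: rho_def dot_square_norm)
  ultimately show ?thesis
    by (auto elim!: tendsto_within_subset simp: direction_pairs_def)
qed

lemma eventually_q_fun_less:
  assumes "convex_body K" "norm u = 1" "q_fun K u < c"
  shows "\<forall>\<^sub>F p in at (u, u) within direction_pairs. q_fun K (fst p) < c \<and> q_fun K (snd p) < c"
proof -
  \<comment> \<open>The complement is open in the whole space; it also contains all non-unit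
    vectors, but \<open>direction_pairs\<close> consists of unit vectors.\<close>
  define U where "U = - {v. norm v = 1 \<and> c \<le> q_fun K v}"
  have "open (U \<times> U)"
    unfolding U_def by (intro open_Times open_Compl compact_imp_closed compact_q_fun_superlevel assms)
  moreover have "(u, u) \<in> U \<times> U"
    using assms by (simp add: U_def)
  ultimately show ?thesis
    unfolding eventually_at_topological
    by (intro exI[of _ "U \<times> U"]) (auto simp: U_def direction_pairs_def)
qed

text \<open>Dividing the quadratic estimate by \<open>rho\<close> leaves the larger of the two q
  values plus \<open>C * rho\<close>. Near \<open>(u, u)\<close> semicontinuity and the vanishing of
  \<open>rho\<close> each cost at most half of \<epsilon>.\<close>

lemma d_prime_le_q_fun:
  assumes "convex_body K" "norm u = 1"
  shows "d_prime K u \<le> ereal (q_fun K u)"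
proof (rule ereal_le_epsilon2)
  fix \<epsilon> :: real assume \<epsilon>: "0 < \<epsilon>"
  obtain C where C: "C \<ge> 0"
    "\<And>u v. norm u = 1 \<Longrightarrow> norm v = 1 \<Longrightarrow>
       \<bar>max_chord K u - max_chord K v\<bar> \<le> rho u v * max (q_fun K u) (q_fun K v) + C * (rho u v)\<^sup>2"
    using max_chord_quadratic_estimate[OF assms(1)] by blast
  have "((\<lambda>p. C * rho (fst p) (snd p)) \<longlongrightarrow> C * 0) (at (u, u) within direction_pairs)"
    by (intro tendsto_mult tendsto_const rho_tendsto_zero assms)
  then have "\<forall>\<^sub>F p in at (u, u) within direction_pairs. C * rho (fst p) (snd p) < \<epsilon> / 2"
    using \<epsilon> by (intro order_tendstoD(2)) auto
  moreover have "\<forall>\<^sub>F p in at (u, u) within direction_pairs.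
      q_fun K (fst p) < q_fun K u + \<epsilon> / 2 \<and> q_fun K (snd p) < q_fun K u + \<epsilon> / 2"
    using \<epsilon> by (intro eventually_q_fun_less assms) auto
  moreover have "\<forall>\<^sub>F p in at (u, u) within direction_pairs. p \<in> direction_pairs"
    by (auto simp: eventually_at_filter)
  ultimately have "\<forall>\<^sub>F p in at (u, u) within direction_pairs.
      (case p of (v, w) \<Rightarrow> ereal (Delta_d K v w)) \<le> ereal (q_fun K u + \<epsilon>)"
  proof eventually_elim
    case (elim p)
    obtain v w where p: "p = (v, w)" by (cases p)
    have vw: "norm v = 1" "norm w = 1"
      using elim p by (auto simp: direction_pairs_def)
    have pos: "rho v w > 0"
      using rho_pos elim p by blast
    have "Delta_d K v w \<le> max (q_fun K v) (q_fun K w) + C * rho v w"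
      using C(2)[OF vw] pos by (simp add: Delta_d_def divide_le_eq algebra_simps power2_eq_square)
    also have "\<dots> \<le> q_fun K u + \<epsilon>"
      using elim p by auto
    finally show ?case by (simp add: p)
  qed
  then have "d_prime K u \<le> ereal (q_fun K u + \<epsilon>)"
    unfolding d_prime_def by (rule Limsup_bounded)
  then show "d_prime K u \<le> ereal (q_fun K u) + ereal \<epsilon>" by simp
qed

theorem proposition16:
  fixes K :: "(real ^ 'n) set"
  assumes "CARD('n) \<ge> 2" and "convex_body K"
  shows "(SUP (u, v) \<in> direction_pairs. ereal (Delta_d K u v)) \<le> ereal (N_hat K) \<and>
         (\<forall>u \<in> sphere 0 1. d_prime K u \<le> ereal (q_fun K u))"
proof
  show "(SUP (u, v) \<in> direction_pairs. ereal (Delta_d K u v)) \<le> ereal (N_hat K)"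
  proof (rule SUP_least)
    fix p :: "(real ^ 'n) \<times> (real ^ 'n)" assume p: "p \<in> direction_pairs"
    obtain u v where uv: "p = (u, v)" by (cases p)
    have "norm u = 1" "norm v = 1"
      using p uv by (auto simp: direction_pairs_def)
    then have "Delta_d K u v \<le> N_hat K"
      using max_chord_lipschitz[OF assms(2), of u v] rho_pos[of u v] p uv
      by (simp add: Delta_d_def pos_divide_le_eq)
    then show "(case p of (u, v) \<Rightarrow> ereal (Delta_d K u v)) \<le> ereal (N_hat K)"
      by (simp add: uv)
  qed
  show "\<forall>u \<in> sphere 0 1. d_prime K u \<le> ereal (q_fun K u)"
    using d_prime_le_q_fun[OF assms(2)] by simp
qed

end
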